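(* Let $d\ge1$, let $\sigma>4/d$ with also $\sigma<\frac{4}{d-4}$ if $d>4$, and let $\nu\in\mathbb{R}$, $\kappa>0$. Let $S(\rho)$ be a solution of $$-\nu S(\rho)+i\frac{\kappa^4}{4}\left(\frac{2}{\sigma}S+\rho S'\right)-\Delta_\rho^2S+|S|^{2\sigma}S=0,\qquad S'(0)=S'''(0)=0,\qquad S(\infty)=0,$$ with zero Hamiltonian, $H[S]=0$, and let $c_1,\dots,c_4$ be the coefficients in its large-$\rho$ behavior $S\sim c_1S_1+c_2S_2+c_3S_3+c_4S_4$ (see context). Then: 1. $c_2=c_3=0$. 2. If $c_1\ne0$, then $$S(\rho)\sim c_1S_1(\rho),\qquad\rho\to\infty,$$ or, equivalently, $$\lim_{\rho\to\infty}\left(\rho S'+\left(\frac2\sigma+i\frac{4\nu}{\kappa^4}\right)S\right)\rho^{\gamma}=0,$$ where $$\gamma_0<\gamma<\gamma_1,\qquad\gamma_0=\frac23\left(d-2-\frac2\sigma\right),\qquad\gamma_1=4+\frac2\sigma .$$ Moreover, $S\in L^{2\sigma+2}(\mathbb{R}^d)$ and $S\notin L^2(\mathbb{R}^d)$.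
   Context: $S:[0,\infty)\to\mathbb{C}$ is identified with the radial function $\mathbf{x}\mapsto S(|\mathbf{x}|)$ on $\mathbb{R}^d$, $S(\infty):=\lim_{\rho\to\infty}S(\rho)$, and $$\Delta_\rho^2=\partial_\rho^4+\frac{2(d-1)}{\rho}\partial_\rho^3+\frac{(d-1)(d-3)}{\rho^2}\partial_\rho^2-\frac{(d-1)(d-3)}{\rho^3}\partial_\rho .$$ The Hamiltonian is $H[u]=\|\Delta u\|_{2}^2-\frac{1}{\sigma+1}\|u\|_{2\sigma+2}^{2\sigma+2}$ (norms over $\mathbb{R}^d$); $H[S]=0$ includes that it is finite, i.e. $\Delta S\in L^2$ and $S\in L^{2\sigma+2}$. As $\rho\to\infty$ the nonlinear term is negligible and the large-$\rho$ behavior of a solution is $$S\sim c_1S_1+c_2S_2+c_3S_3+c_4S_4,\qquad c_i\in\mathbb{C},$$ where $S_1,\dots,S_4$ are the solutions of the linear equation $-\nu S+i\frac{\kappa^4}{4}(\frac2\sigma S+\rho S')-\Delta_\rho^2S=0$ with leading-order behavior $$S_1\sim\rho^{-\frac2\sigma-i\frac{4\nu}{\kappa^4}},\qquad S_2\sim\rho^{-\frac{2}{3\sigma}(\sigma d-1)}\exp\left(-i\frac{3}{4\sqrt[3]{4}}(\kappa\rho)^{4/3}+i\frac{4\nu}{3\kappa^4}\log\rho\right),$$ $$S_{3},S_4\sim\rho^{-\frac{2}{3\sigma}(\sigma d-1)}\exp\left(\pm\frac{3\sqrt3}{8\sqrt[3]{4}}(\kappa\rho)^{4/3}+i\frac{3}{8\sqrt[3]{4}}(\kappa\rho)^{4/3}+i\frac{4\nu}{3\kappa^4}\log\rho\right)$$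 ($+$ for $S_3$, $-$ for $S_4$). The relation for $S$ means that $S$ is a sum of four terms $c_iS_i(1+o(1))$, with relative correction $O(\rho^{-4})$ in the $c_1$ term, and that it may be differentiated termwise. *)

theory Defs
  imports "HOL-Analysis.Analysis" "HOL-Library.Landau_Symbols"
begin

(* A profile on [0,\<infinity>) is a function on type real whose values at negative arguments
   are irrelevant: all derivatives are taken within {0..}, hence they are right derivatives at 0
   and ordinary derivatives at positive arguments. *)
definition rderiv :: "nat \<Rightarrow> (real \<Rightarrow> complex) \<Rightarrow> real \<Rightarrow> complex" where
  "rderiv k f = ((\<lambda>g \<rho>. vector_derivative g (at \<rho> within {0..})) ^^ k) f"

definition bilaplace_radial :: "nat \<Rightarrow> (real \<Rightarrow> complex) \<Rightarrow> real \<Rightarrow> complex" where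
  "bilaplace_radial d f \<rho> =
     rderiv 4 f \<rho>
     + (2 * (real d - 1) / \<rho>) *\<^sub>R rderiv 3 f \<rho>
     + ((real d - 1) * (real d - 3) / \<rho>^2) *\<^sub>R rderiv 2 f \<rho>
     - ((real d - 1) * (real d - 3) / \<rho>^3) *\<^sub>R rderiv 1 f \<rho>"

definition linear_part ::
    "nat \<Rightarrow> real \<Rightarrow> real \<Rightarrow> real \<Rightarrow> (real \<Rightarrow> complex) \<Rightarrow> real \<Rightarrow> complex" where
  "linear_part d \<sigma> \<nu> \<kappa> f \<rho> =
     - of_real \<nu> * f \<rho>
     + \<i> * of_real (\<kappa>^4 / 4) * (of_real (2 / \<sigma>) * f \<rho> + of_real \<rho> * rderiv 1 f \<rho>)
     - bilaplace_radial d f \<rho>"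

(* Classical solutions: C^3 on [0,\<infinity>), four times differentiable on (0,\<infinity>); the
   equation, whose coefficients are singular at 0, is imposed for \<rho> > 0. *)
definition profile_solution ::
    "nat \<Rightarrow> real \<Rightarrow> real \<Rightarrow> real \<Rightarrow> (real \<Rightarrow> complex) \<Rightarrow> bool" where
  "profile_solution d \<sigma> \<nu> \<kappa> S \<longleftrightarrow>
     (\<forall>k<3. \<forall>\<rho>\<ge>0. rderiv k S differentiable (at \<rho> within {0..})) \<and>
     continuous_on {0..} (rderiv 3 S) \<and>
     (\<forall>\<rho>>0. rderiv 3 S differentiable (at \<rho>)) \<and>
     (\<forall>\<rho>>0. linear_part d \<sigma> \<nu> \<kappa> S \<rho> + of_real (cmod (S \<rho>) powr (2 * \<sigma>)) * S \<rho> = 0) \<and>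
     rderiv 1 S 0 = 0 \<and> rderiv 3 S 0 = 0 \<and>
     (S \<longlongrightarrow> 0) at_top"

definition linear_solution ::
    "nat \<Rightarrow> real \<Rightarrow> real \<Rightarrow> real \<Rightarrow> (real \<Rightarrow> complex) \<Rightarrow> bool" where
  "linear_solution d \<sigma> \<nu> \<kappa> f \<longleftrightarrow>
     (\<forall>k<4. \<forall>\<rho>>0. rderiv k f differentiable (at \<rho>)) \<and>
     (\<forall>\<rho>>0. linear_part d \<sigma> \<nu> \<kappa> f \<rho> = 0)"

definition leading_form ::
    "nat \<Rightarrow> real \<Rightarrow> real \<Rightarrow> real \<Rightarrow> nat \<Rightarrow> real \<Rightarrow> complex" where
  "leading_form d \<sigma> \<nu> \<kappa> i \<rho> =
     (let A = of_real (\<rho> powr (- (2 / (3 * \<sigma>)) * (\<sigma> * real d - 1)));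
          L = \<i> * of_real (4 * \<nu> / (3 * \<kappa>^4) * ln \<rho>);
          X = (\<kappa> * \<rho>) powr (4 / 3)
      in if i = 1 then of_real \<rho> powr (- of_real (2 / \<sigma>) - \<i> * of_real (4 * \<nu> / \<kappa>^4))
         else if i = 2 then A * exp (- \<i> * of_real (3 / (4 * root 3 4) * X) + L)
         else if i = 3 then A * exp (of_real (3 * sqrt 3 / (8 * root 3 4) * X)
                                     + \<i> * of_real (3 / (8 * root 3 4) * X) + L)
         else A * exp (- of_real (3 * sqrt 3 / (8 * root 3 4) * X)
                       + \<i> * of_real (3 / (8 * root 3 4) * X) + L))"

(* The leading-order behaviour is understood together with its derivatives. Agreement of the
   functions alone would determine the first solution only up to multiples of the second and the
   fourth, which decay faster, and coefficients with respect to the system would be ambiguous. *)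
definition linear_system ::
    "nat \<Rightarrow> real \<Rightarrow> real \<Rightarrow> real \<Rightarrow> (nat \<Rightarrow> real \<Rightarrow> complex) \<Rightarrow> bool" where
  "linear_system d \<sigma> \<nu> \<kappa> B \<longleftrightarrow>
     (\<forall>i\<in>{1..4}. linear_solution d \<sigma> \<nu> \<kappa> (B i) \<and>
        (\<forall>k\<le>4. rderiv k (B i) \<sim>[at_top] rderiv k (leading_form d \<sigma> \<nu> \<kappa> i)))"

(* S ~ c 1 B 1 + ... + c 4 B 4: each derivative up to the order of the equation is the sum of
   the corresponding derivatives of the four terms, each up to a factor 1 + o(1), respectively
   1 + O(1/\<rho>^4) for the first term. A term with c i = 0 is absent. *)
definition large_radius_expansion ::
    "(nat \<Rightarrow> real \<Rightarrow> complex) \<Rightarrow> (nat \<Rightarrow> complex) \<Rightarrow> (real \<Rightarrow> complex) \<Rightarrow> bool" where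
  "large_radius_expansion B c S \<longleftrightarrow>
     (\<forall>k\<le>4. \<exists>e :: nat \<Rightarrow> real \<Rightarrow> complex.
        (\<forall>\<^sub>F \<rho> in at_top. rderiv k S \<rho> = (\<Sum>i=1..4. c i * rderiv k (B i) \<rho> * (1 + e i \<rho>))) \<and>
        (\<forall>i\<in>{1..4}. (e i \<longlongrightarrow> 0) at_top) \<and>
        e 1 \<in> O[at_top](\<lambda>\<rho>. of_real (1 / \<rho>^4)))"

definition radial :: "(real \<Rightarrow> complex) \<Rightarrow> 'a::euclidean_space \<Rightarrow> complex" where
  "radial S x = S (norm x)"

definition partial_deriv ::
    "'a::euclidean_space \<Rightarrow> ('a \<Rightarrow> complex) \<Rightarrow> 'a \<Rightarrow> complex" where
  "partial_deriv b u x = vector_derivative (\<lambda>t. u (x + t *\<^sub>R b)) (at 0)"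

definition laplacian :: "('a::euclidean_space \<Rightarrow> complex) \<Rightarrow> 'a \<Rightarrow> complex" where
  "laplacian u x = (\<Sum>b\<in>Basis. partial_deriv b (partial_deriv b u) x)"

definition Lp :: "real \<Rightarrow> ('a::euclidean_space \<Rightarrow> complex) set" where
  "Lp p = {u \<in> borel_measurable lborel. integrable lborel (\<lambda>x. norm (u x) powr p)}"

definition Lp_norm :: "real \<Rightarrow> ('a::euclidean_space \<Rightarrow> complex) \<Rightarrow> real" where
  "Lp_norm p u = (\<integral>x. norm (u x) powr p \<partial>lborel) powr (1 / p)"

(* Meaningful only if u lies in Lp (2 * \<sigma> + 2) and its Laplacian in Lp 2. *)
definition Hamiltonian :: "real \<Rightarrow> ('a::euclidean_space \<Rightarrow> complex) \<Rightarrow> real" where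
  "Hamiltonian \<sigma> u =
     Lp_norm 2 (laplacian u) ^ 2 - 1 / (\<sigma> + 1) * Lp_norm (2 * \<sigma> + 2) u powr (2 * \<sigma> + 2)"

end

theory Submission
  imports Defs "HOL-Real_Asymp.Real_Asymp"
begin

text \<open>
  The third solution is unbounded, so \<open>S \<rightarrow> 0\<close> forces \<open>c\<^sub>3 = 0\<close>. If \<open>c\<^sub>2 \<noteq> 0\<close>, the second
  solution would dominate the Laplacian at infinity: \<open>\<bar>\<Delta>S\<bar>\<close> would be of order
  \<open>\<rho> powr (2/3 * (1 + 1/\<sigma> - d))\<close>, which is not square integrable on \<open>\<real>\<^sup>d\<close> because
  \<open>\<sigma> (d - 4) < 4\<close>; this condition also makes the contribution of the first solution, of order
  \<open>\<rho> powr (- 2/\<sigma> - 2)\<close>, smaller. Only the first solution and the exponentially small fourth one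
  remain, and \<open>\<rho> powr (- 2/\<sigma>)\<close> is not square integrable because \<open>\<sigma> d > 4\<close>.
\<close>


section \<open>Derivatives of profiles\<close>

lemma rderiv_0 [simp]: "rderiv 0 f = f"
  by (simp add: rderiv_def)

lemma rderiv_Suc:
  "rderiv (Suc k) f \<rho> = vector_derivative (rderiv k f) (at \<rho> within {0..})"
  by (simp add: rderiv_def)

lemma at_within_nonneg: "\<rho> > 0 \<Longrightarrow> at \<rho> within {0..} = at (\<rho>::real)"
  by (rule at_within_interior) simp

text \<open>Closed forms of derivatives are known only at positive arguments. These form an open
  set, so agreement there already determines the next derivative.\<close>

lemma rderiv_Suc_eq:
  assumes "\<rho> > 0" "\<And>x. x > 0 \<Longrightarrow> rderiv k f x = g x" "(g has_vector_derivative g') (at \<rho>)"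
  shows "rderiv (Suc k) f \<rho> = g'"
proof -
  have "(rderiv k f has_vector_derivative g') (at \<rho>)"
    by (rule has_vector_derivative_transform_within_open[OF assms(3), of "{0<..}"])
       (use assms in auto)
  thus ?thesis
    using assms(1) by (simp add: rderiv_Suc at_within_nonneg vector_derivative_at)
qed

text \<open>The leading forms are identified with their WKB shape only at positive arguments; this
  carries the identification over to all derivatives.\<close>

lemma rderiv_cong:
  assumes "\<And>x. x > 0 \<Longrightarrow> f x = g x" "\<rho> > 0"
  shows "rderiv k f \<rho> = rderiv k g \<rho>"
  using assms(2)
proof (induction k arbitrary: \<rho>)
  case (Suc k)
  have "\<forall>\<^sub>F x in nhds \<rho>. x \<in> {0<..} \<longrightarrow> rderiv k f x = rderiv k g x"
    using Suc.IH by (intro always_eventually) auto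
  moreover have "\<forall>\<^sub>F x in nhds \<rho>. x \<in> {0<..}"
    using Suc.prems by (intro eventually_nhds_in_open) auto
  ultimately have "\<forall>\<^sub>F x in nhds \<rho>. rderiv k f x = rderiv k g x"
    by eventually_elim auto
  hence "vector_derivative (rderiv k f) (at \<rho>) = vector_derivative (rderiv k g) (at \<rho>)"
    by (intro vector_derivative_cong_eq) auto
  thus ?case
    using Suc.prems by (simp add: rderiv_Suc at_within_nonneg)
qed (use assms in auto)

lemma rderiv_Suc_has_vector_derivative:
  assumes "\<rho> > 0" "rderiv k f differentiable (at \<rho> within {0..})"
  shows "(rderiv k f has_vector_derivative rderiv (Suc k) f \<rho>) (at \<rho>)"
  using assms vector_derivative_works[of "rderiv k f" "at \<rho>"]
  by (simp add: rderiv_Suc at_within_nonneg)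


section \<open>Powers and exponentials at infinity\<close>

text \<open>Complex-valued because Landau symbols compare functions with the same codomain, and the
  profiles are complex.\<close>

definition pw :: "real \<Rightarrow> real \<Rightarrow> complex" where
  "pw p \<rho> = of_real (\<rho> powr p)"

lemma norm_pw [simp]: "norm (pw p \<rho>) = \<rho> powr p"
  by (simp add: pw_def)

lemma pw_mult: "pw p \<rho> * pw q \<rho> = pw (p + q) \<rho>"
  by (simp add: pw_def powr_add)

lemma pw_divide: "\<rho> > 0 \<Longrightarrow> pw p \<rho> / pw q \<rho> = pw (p - q) \<rho>"
  by (simp add: pw_def powr_diff)

lemma pw_smallo: "p < q \<Longrightarrow> pw p \<in> o[at_top](pw q)"
  by (subst landau_o.small.norm_iff [symmetric]) (simp, real_asymp)

lemma pw_bigo: "p \<le> q \<Longrightarrow> pw p \<in> O[at_top](pw q)"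
  using landau_o.small_imp_big[OF pw_smallo[of p q]] by (cases "p = q") auto

lemma pw_tendsto_0: "p < 0 \<Longrightarrow> (pw p \<longlongrightarrow> 0) at_top"
  by (subst tendsto_norm_zero_iff [symmetric]) (simp, real_asymp)

lemma bigo_pw_mult:
  assumes "f \<in> O[at_top](pw p)" "g \<in> O[at_top](pw q)"
  shows "(\<lambda>\<rho>. f \<rho> * g \<rho>) \<in> O[at_top](pw (p + q))"
  using landau_o.big.mult[OF assms] by (simp add: pw_mult)

lemma bigo_pw_tendsto_0:
  assumes "f \<in> O[at_top](pw p)" "p < 0"
  shows "(f \<longlongrightarrow> 0) at_top"
proof -
  have "pw p \<in> o[at_top](\<lambda>_. 1)"
    using pw_tendsto_0[OF assms(2)] by (intro smalloI_tendsto) auto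
  hence "f \<in> o[at_top](\<lambda>_. 1)"
    by (rule landau_o.big_small_trans[OF assms(1)])
  thus ?thesis
    by (auto dest: smalloD_tendsto)
qed

section \<open>Exponentials with a phase of order \<open>\<rho> powr (4/3)\<close>\<close>

text \<open>All four leading forms have this WKB shape, the powers being the case \<open>a = 0\<close>, and the
  shape is stable under differentiation up to shifts of \<open>b\<close>.\<close>

definition wkb :: "complex \<Rightarrow> complex \<Rightarrow> real \<Rightarrow> complex" where
  "wkb a b \<rho> = exp (a * of_real (\<rho> powr (4 / 3)) + b * of_real (ln \<rho>))"

lemma norm_wkb: "\<rho> > 0 \<Longrightarrow> norm (wkb a b \<rho>) = exp (Re a * \<rho> powr (4 / 3)) * \<rho> powr Re b"
  by (simp add: wkb_def exp_add powr_def norm_mult)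

lemma wkb_add_real:
  "\<rho> > 0 \<Longrightarrow> wkb a (b + of_real x) \<rho> = wkb a b \<rho> * of_real (\<rho> powr x)"
  by (simp add: wkb_def powr_def exp_add algebra_simps flip: exp_of_real)

lemma wkb_has_vector_derivative:
  assumes "\<rho> > 0"
  shows "(wkb a b has_vector_derivative
           4 / 3 * a * wkb a (b + 1 / 3) \<rho> + b * wkb a (b - 1) \<rho>) (at \<rho>)"
proof -
  have "((\<lambda>\<rho>. a * of_real (\<rho> powr (4 / 3)) + b * of_real (ln \<rho>)) has_vector_derivative
          a * of_real (4 / 3 * \<rho> powr (1 / 3)) + b * of_real (\<rho> powr (-1))) (at \<rho>)"
    using assms
    by (auto intro!: derivative_eq_intros has_vector_derivative_mult_right
             has_vector_derivative_of_real
             simp: has_real_derivative_iff_has_vector_derivative [symmetric]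
               powr_minus inverse_eq_divide)
  hence "(wkb a b has_vector_derivative
          (a * of_real (4 / 3 * \<rho> powr (1 / 3)) + b * of_real (\<rho> powr (-1))) * wkb a b \<rho>) (at \<rho>)"
    unfolding wkb_def [abs_def] 
    using field_vector_diff_chain_at[OF _ DERIV_exp] by (fastforce simp: o_def)
  also have "(a * of_real (4 / 3 * \<rho> powr (1 / 3)) + b * of_real (\<rho> powr (-1))) * wkb a b \<rho> =
      4 / 3 * a * wkb a (b + 1 / 3) \<rho> + b * wkb a (b - 1) \<rho>"
    \<comment> \<open>The factors \<open>\<rho> powr (1/3)\<close> and
      \<open>\<rho> powr (-1)\<close> coming from the exponent are absorbed as shifts of
      \<open>b\<close>.\<close>
    using wkb_add_real[OF assms, of a b "1 / 3"] wkb_add_real[OF assms, of a b "-1"]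
    by (simp add: algebra_simps)
  finally show ?thesis .
qed

lemma rderiv_wkb_power:
  assumes "\<rho> > 0"
  shows "rderiv k (wkb 0 b) \<rho> = (\<Prod>j<k. b - of_nat j) * wkb 0 (b - of_nat k) \<rho>"
  using assms
proof (induction k arbitrary: \<rho>)
  case (Suc k)
  have "rderiv (Suc k) (wkb 0 b) \<rho> =
      (\<Prod>j<k. b - of_nat j) *
        (4 / 3 * 0 * wkb 0 (b - of_nat k + 1 / 3) \<rho> + (b - of_nat k) * wkb 0 (b - of_nat k - 1) \<rho>)"
    by (rule rderiv_Suc_eq[OF Suc.prems Suc.IH
          has_vector_derivative_mult_right[OF wkb_has_vector_derivative[OF Suc.prems]]])
  thus ?case
    by (simp add: algebra_simps)
qed simp

lemma rderiv_wkb_1: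
  "\<rho> > 0 \<Longrightarrow> rderiv 1 (wkb a b) \<rho> = 4 / 3 * a * wkb a (b + 1 / 3) \<rho> + b * wkb a (b - 1) \<rho>"
  unfolding One_nat_def by (rule rderiv_Suc_eq[OF _ _ wkb_has_vector_derivative]) simp_all

lemma rderiv_wkb_2:
  assumes "\<rho> > 0"
  shows "rderiv 2 (wkb a b) \<rho> =
    (4 / 3 * a)\<^sup>2 * wkb a (b + 2 / 3) \<rho> + 4 / 3 * a * (2 * b + 1 / 3) * wkb a (b - 2 / 3) \<rho>
      + b * (b - 1) * wkb a (b - 2) \<rho>"
proof -
  have "rderiv (Suc 1) (wkb a b) \<rho> =
     4 / 3 * a * (4 / 3 * a * wkb a (b + 1 / 3 + 1 / 3) \<rho>
         + (b + 1 / 3) * wkb a (b + 1 / 3 - 1) \<rho>)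
     + b * (4 / 3 * a * wkb a (b - 1 + 1 / 3) \<rho> + (b - 1) * wkb a (b - 1 - 1) \<rho>)"
    by (rule rderiv_Suc_eq[OF assms rderiv_wkb_1])
       (assumption, intro has_vector_derivative_add has_vector_derivative_mult_right
          wkb_has_vector_derivative assms)
  \<comment> \<open>Both mixed terms land on the shift -2/3, so their coefficients b + 1/3 and b add
    up to 2 b + 1/3.\<close>
  moreover have "b + 1 / 3 + 1 / 3 = b + 2 / 3" "b + 1 / 3 - 1 = b - 2 / 3"
      "b - 1 + 1 / 3 = b - 2 / 3" "b - 1 - 1 = b - 2"
    by (simp_all add: field_simps)
  ultimately show ?thesis
    by (simp add: algebra_simps power2_eq_square numeral_2_eq_2)
qed

text \<open>Serves the case of a decaying exponential, which beats every power: then neither the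
  coefficients nor the shifts matter, only that there are finitely many terms with the same
  \<open>a\<close>.\<close>

lemma rderiv_wkb_sum:
  "\<exists>ws. \<forall>\<rho>>0. rderiv k (wkb a b) \<rho> = (\<Sum>(w, s)\<leftarrow>ws. w * wkb a s \<rho>)"
proof (induction k)
  case 0
  show ?case
    by (rule exI[of _ "[(1, b)]"]) simp
next
  case (Suc k)
  then obtain ws where ws: "\<forall>\<rho>>0. rderiv k (wkb a b) \<rho> = (\<Sum>(w, s)\<leftarrow>ws. w * wkb a s \<rho>)"
    by blast
  define ws' where
    "ws' = concat (map (\<lambda>(w, s). [(w * (4 / 3 * a), s + 1 / 3), (w * s, s - 1)]) ws)"
  have deriv: "((\<lambda>\<rho>. \<Sum>(w, s)\<leftarrow>ws. w * wkb a s \<rho>) has_vector_derivative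
      (\<Sum>(w, s)\<leftarrow>ws'. w * wkb a s \<rho>)) (at \<rho>)" if "\<rho> > 0" for \<rho>
    unfolding ws'_def
  proof (induction ws)
    case (Cons p ws)
    obtain w s where p: "p = (w, s)" by (cases p)
    show ?case
      using has_vector_derivative_add[OF
          has_vector_derivative_mult_right[OF wkb_has_vector_derivative[OF that, of a s], of w]
          Cons.IH]
      by (simp add: p algebra_simps)
  qed simp
  show ?case
    using rderiv_Suc_eq[OF _ _ deriv] ws by blast
qed

lemma wkb_bigtheta:
  assumes "Re a = 0"
  shows "wkb a b \<in> \<Theta>[at_top](pw (Re b))"
proof (rule bigthetaI_cong [THEN landau_theta.norm_iff [THEN iffD1]])
  show "\<forall>\<^sub>F \<rho> in at_top. norm (wkb a b \<rho>) = norm (pw (Re b) \<rho>)"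
    using eventually_gt_at_top[of 0] by eventually_elim (simp add: norm_wkb assms)
qed

lemma wkb_smallo:
  assumes "Re a < 0"
  shows "wkb a b \<in> o[at_top](pw p)"
proof -
  have "(\<lambda>\<rho>. exp (Re a * \<rho> powr (4 / 3)) * \<rho> powr Re b) \<in> o[at_top](\<lambda>\<rho>. \<rho> powr p)"
    using assms by real_asymp
  moreover have "\<forall>\<^sub>F \<rho> in at_top. exp (Re a * \<rho> powr (4 / 3)) * \<rho> powr Re b = norm (wkb a b \<rho>)"
    using eventually_gt_at_top[of 0] by eventually_elim (simp add: norm_wkb)
  ultimately have "(\<lambda>\<rho>. norm (wkb a b \<rho>)) \<in> o[at_top](\<lambda>\<rho>. norm (pw p \<rho>))"
    by (simp add: landau_o.small.in_cong)
  thus ?thesis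
    by (simp only: landau_o.small.norm_iff)
qed

lemma wkb_at_infinity:
  assumes "Re a > 0"
  shows "filterlim (wkb a b) at_infinity at_top"
proof (rule filterlim_norm_at_top_imp_at_infinity)
  have "filterlim (\<lambda>\<rho>. exp (Re a * \<rho> powr (4 / 3)) * \<rho> powr Re b) at_top at_top"
    using assms by real_asymp
  thus "filterlim (\<lambda>\<rho>. norm (wkb a b \<rho>)) at_top at_top"
    by (rule filterlim_mono_eventually)
       (auto intro: eventually_mono[OF eventually_gt_at_top[of 0]] simp: norm_wkb)
qed

lemma rderiv_wkb_power_bigtheta:
  assumes "Re b < 0"
  shows "rderiv k (wkb 0 b) \<in> \<Theta>[at_top](pw (Re b - real k))"
proof -
  \<comment> \<open>A negative real part keeps \<open>b\<close> away from the natural numbers, so no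
    derivative loses its leading coefficient.\<close>
  have "(\<Prod>j<k. b - of_nat j) \<noteq> 0"
    using assms by auto
  hence "(\<lambda>\<rho>. (\<Prod>j<k. b - of_nat j) * wkb 0 (b - of_nat k) \<rho>) \<in> \<Theta>[at_top](pw (Re b - real k))"
    using wkb_bigtheta[of 0 "b - of_nat k"] by simp
  moreover have "\<forall>\<^sub>F \<rho> in at_top.
      (\<Prod>j<k. b - of_nat j) * wkb 0 (b - of_nat k) \<rho> = rderiv k (wkb 0 b) \<rho>"
    using eventually_gt_at_top[of 0] by eventually_elim (simp add: rderiv_wkb_power)
  ultimately show ?thesis
    by (simp add: landau_theta.in_cong)
qed

lemma rderiv_wkb_smallo:
  assumes "Re a < 0"
  shows "rderiv k (wkb a b) \<in> o[at_top](pw p)"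
proof -
  obtain ws where ws: "\<forall>\<rho>>0. rderiv k (wkb a b) \<rho> = (\<Sum>(w, s)\<leftarrow>ws. w * wkb a s \<rho>)"
    using rderiv_wkb_sum by blast
  have "(\<lambda>\<rho>. \<Sum>(w, s)\<leftarrow>ws. w * wkb a s \<rho>) \<in> o[at_top](pw p)"
  proof (induction ws)
    case (Cons q ws)
    thus ?case
      using wkb_smallo[OF assms, of "snd q" p]
      by (cases q) (auto intro!: sum_in_smallo)
  qed simp
  moreover have "\<forall>\<^sub>F \<rho> in at_top. (\<Sum>(w, s)\<leftarrow>ws. w * wkb a s \<rho>) = rderiv k (wkb a b) \<rho>"
    using eventually_gt_at_top[of 0] by eventually_elim (simp add: ws)
  ultimately show ?thesis
    by (simp add: landau_o.small.in_cong)
qed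

text \<open>An upper bound suffices here, since the first derivative enters the Laplacian only after
  division by \<rho>.\<close>

lemma rderiv_wkb_1_bigo:
  assumes "Re a = 0"
  shows "rderiv 1 (wkb a b) \<in> O[at_top](pw (Re b + 1 / 3))"
proof -
  have "wkb a (b + 1 / 3) \<in> O[at_top](pw (Re b + 1 / 3))"
    using wkb_bigtheta[OF assms, of "b + 1 / 3"] by (simp add: bigtheta_def)
  moreover have "wkb a (b - 1) \<in> O[at_top](pw (Re b + 1 / 3))"
    using landau_o.big_trans[OF bigthetaD1[OF wkb_bigtheta[OF assms, of "b - 1"]] pw_bigo]
    by simp
  ultimately have "(\<lambda>\<rho>. 4 / 3 * a * wkb a (b + 1 / 3) \<rho> + b * wkb a (b - 1) \<rho>)
      \<in> O[at_top](pw (Re b + 1 / 3))"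
    by (intro sum_in_bigo landau_o.big.mult_in_1) auto
  moreover have "\<forall>\<^sub>F \<rho> in at_top. 4 / 3 * a * wkb a (b + 1 / 3) \<rho> + b * wkb a (b - 1) \<rho> =
      rderiv 1 (wkb a b) \<rho>"
    using eventually_gt_at_top[of 0] by eventually_elim (simp only: rderiv_wkb_1)
  ultimately show ?thesis
    by (simp add: landau_o.big.in_cong)
qed

text \<open>The term with the square of \<open>a\<close> is the largest, its coefficient being
  nonzero; the other two are smaller by \<open>\<rho> powr (-4/3)\<close> and
  \<open>\<rho> powr (-8/3)\<close>.\<close>

lemma rderiv_wkb_2_bigtheta:
  assumes "Re a = 0" "a \<noteq> 0"
  shows "rderiv 2 (wkb a b) \<in> \<Theta>[at_top](pw (Re b + 2 / 3))"
proof -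
  let ?f = "\<lambda>\<rho>. (4 / 3 * a)\<^sup>2 * wkb a (b + 2 / 3) \<rho>"
  let ?g = "\<lambda>\<rho>. 4 / 3 * a * (2 * b + 1 / 3) * wkb a (b - 2 / 3) \<rho>
      + b * (b - 1) * wkb a (b - 2) \<rho>"
  have f: "?f \<in> \<Theta>[at_top](pw (Re b + 2 / 3))"
    using wkb_bigtheta[OF assms(1), of "b + 2 / 3"] assms(2) by simp
  have "wkb a (b - of_real x) \<in> o[at_top](pw (Re b + 2 / 3))" if "x > 0" for x
    using landau_o.big_small_trans[OF bigthetaD1[OF wkb_bigtheta[OF assms(1), of "b - of_real x"]]
        pw_smallo[of _ "Re b + 2 / 3"]] that by simp
  from this[of "2 / 3"] this[of 2] have "?g \<in> o[at_top](pw (Re b + 2 / 3))"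
    by (intro sum_in_smallo) auto
  hence "?g \<in> o[at_top](?f)"
    using f by (simp add: landau_o.small.cong_bigtheta)
  hence "(\<lambda>\<rho>. ?f \<rho> + ?g \<rho>) \<in> \<Theta>[at_top](?f)"
    by (intro asymp_equiv_imp_bigtheta smallo_imp_asymp_equiv) simp
  hence "(\<lambda>\<rho>. ?f \<rho> + ?g \<rho>) \<in> \<Theta>[at_top](pw (Re b + 2 / 3))"
    using f landau_theta.trans by blast
  moreover have "\<forall>\<^sub>F \<rho> in at_top. ?f \<rho> + ?g \<rho> = rderiv 2 (wkb a b) \<rho>"
    using eventually_gt_at_top[of 0] by eventually_elim (simp add: rderiv_wkb_2)
  ultimately show ?thesis
    by (simp add: landau_theta.in_cong)
qed


section \<open>Radial functions\<close>

text \<open>The shells \<open>r \<le> norm x < 2 r\<close> contribute a fixed positive amount to the integral of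
  \<open>norm x powr - DIM('a)\<close>, whereas the shell integrals of an integrable function tend to 0.\<close>

lemma power_lower_bound_not_in_Lp:
  fixes f :: "'a::euclidean_space \<Rightarrow> complex"
  assumes "C > 0" "p > 0" "p * q \<ge> - real DIM('a)"
    and bound: "\<And>x. norm x \<ge> R \<Longrightarrow> C * norm x powr q \<le> norm (f x)"
  shows "f \<notin> Lp p"
proof
  assume "f \<in> Lp p"
  hence int: "integrable lborel (\<lambda>x. norm (f x) powr p)"
    by (simp add: Lp_def)
  define D where "D = DIM('a)"
  have D: "D > 0" by (simp add: D_def)
  \<comment> \<open>The maximum places every shell where \<open>bound\<close> applies and where
    norms are at least 1; the summand \<open>n\<close> pushes the shells to infinity.\<close>
  define r where "r n = real n + max R 1" for n
  have r: "r n \<ge> 1" "r n \<ge> R" "r n \<ge> real n" for n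
    by (auto simp: r_def)
  define A :: "nat \<Rightarrow> 'a set" where "A n = ball 0 (2 * r n) - ball 0 (r n)" for n
  have A [measurable]: "A n \<in> sets borel" for n
    by (simp add: A_def)
  \<comment> \<open>The shell has volume proportional to \<open>r n ^ D\<close>, and on it the
    integrand is at least \<open>C powr p / (2 * r n) ^ D\<close>. The radius cancels in the
    product, leaving \<open>K\<close>.\<close>
  define K where "K = C powr p * unit_ball_vol D * (2 ^ D - 1) / 2 ^ D"
  have "(1::real) < 2 ^ D"
    using D by simp
  hence "K > 0"
    using assms(1) by (simp add: K_def)
  have measure_A: "measure lborel (A n) = unit_ball_vol D * (2 ^ D - 1) * r n ^ D" for n
  proof -
    have "measure lborel (A n) = measure lborel (ball (0::'a) (2 * r n)) - measure lborel (ball (0::'a) (r n))"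
      unfolding A_def
      using r(1)[of n] emeasure_lborel_ball_finite[of "0::'a" "2 * r n"]
      by (intro measure_Diff) auto
    thus ?thesis
      using r(1)[of n] by (simp add: content_ball D_def power_mult_distrib algebra_simps)
  qed
  have fin_A: "emeasure lborel (A n) < \<infinity>" for n
    by (rule le_less_trans[OF emeasure_mono emeasure_lborel_ball_finite[of 0 "2 * r n"]])
       (auto simp: A_def)
  have "(\<lambda>n. \<integral>x. indicator (A n) x * (norm (f x) powr p) \<partial>lborel) \<longlonglongrightarrow> (\<integral>x. 0 \<partial>(lborel :: 'a measure))"
  proof (rule integral_dominated_convergence[OF _ _ int])
    have meas: "(\<lambda>x. norm (f x) powr p) \<in> borel_measurable lborel"
      using int by (rule borel_measurable_integrable)
    show "(\<lambda>x. indicator (A n) x * (norm (f x) powr p)) \<in> borel_measurable lborel" for n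
      using meas by measurable
    have "(\<lambda>n. indicator (A n) x * (norm (f x) powr p)) \<longlonglongrightarrow> 0" for x
    \<comment> \<open>A fixed point lies in no shell whose inner radius exceeds its norm.\<close>
    proof (rule tendsto_eventually)
      obtain N :: nat where "norm x < N"
        using reals_Archimedean2 by blast
      hence "indicator (A n) x = (0::real)" if "n \<ge> N" for n
        using r(3)[of n] that by (auto simp: A_def indicator_def)
      thus "\<forall>\<^sub>F n in sequentially. indicator (A n) x * (norm (f x) powr p) = 0"
        by (auto simp: eventually_sequentially)
    qed
    thus "AE x in lborel. (\<lambda>n. indicator (A n) x * (norm (f x) powr p)) \<longlonglongrightarrow> 0"
      by simp
  qed (auto simp: indicator_def)
  moreover have "K \<le> (\<integral>x. indicator (A n) x * (norm (f x) powr p) \<partial>lborel)" for n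
  proof -
    have le: "C powr p / (2 * r n) ^ D \<le> norm (f x) powr p" if "x \<in> A n" for x
    proof -
      have x: "r n \<le> norm x" "norm x \<le> 2 * r n"
        using that by (auto simp: A_def)
      have norm_x: "norm x > 0"
        using x r(1)[of n] by linarith
      have "C powr p / (2 * r n) ^ D \<le> C powr p / norm x ^ D"
        using x r(1)[of n] assms(1)
        by (intro divide_left_mono power_mono mult_pos_pos zero_less_power) (linarith | simp)+
      also have "\<dots> = C powr p * norm x powr - real D"
        using norm_x powr_realpow[of "norm x" D] by (simp add: powr_minus divide_inverse)
      \<comment> \<open>Since \<open>norm x\<close> is at least 1, the larger exponent gives the
        larger power.\<close>
      also have "\<dots> \<le> C powr p * norm x powr (q * p)"
        using x r(1)[of n] assms by (intro mult_left_mono powr_mono) (auto simp: D_def mult.commute)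
      also have "\<dots> = (C * norm x powr q) powr p"
        using assms(1) by (simp add: powr_mult powr_powr)
      also have "\<dots> \<le> norm (f x) powr p"
        using bound[of x] x r(2)[of n] assms by (intro powr_mono2) auto
      finally show ?thesis .
    qed
    have "K = (\<integral>x. indicator (A n) x * (C powr p / (2 * r n) ^ D) \<partial>lborel)"
      using r(1)[of n] fin_A[of n] by (simp add: measure_A K_def field_simps power_mult_distrib)
    also have "\<dots> \<le> (\<integral>x. indicator (A n) x * (norm (f x) powr p) \<partial>lborel)"
    proof (rule integral_mono)
      show "integrable lborel (\<lambda>x. indicator (A n) x * (C powr p / (2 * r n) ^ D))"
        using fin_A[of n] by (intro integrable_mult_left) auto
      show "integrable lborel (\<lambda>x. indicator (A n) x * (norm (f x) powr p))"
        using integrable_mult_indicator[OF _ int, of "A n"] by simp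
    qed (use le in \<open>auto simp: indicator_def\<close>)
    finally show ?thesis .
  qed
  ultimately have "K \<le> 0"
    by (intro LIMSEQ_le_const) auto
  with \<open>K > 0\<close> show False by simp
qed

text \<open>The origin is exempt because the radial formula for the Laplacian is established only
  away from it.\<close>

lemma radial_not_in_Lp:
  fixes f :: "'a::euclidean_space \<Rightarrow> complex"
  assumes "\<And>x. x \<noteq> 0 \<Longrightarrow> f x = g (norm x)" "g \<in> \<Omega>[at_top](pw q)"
    and "p > 0" "p * q \<ge> - real DIM('a)"
  shows "f \<notin> Lp p"
proof -
  obtain C where C: "C > 0" "\<forall>\<^sub>F \<rho> in at_top. C * norm (pw q \<rho>) \<le> norm (g \<rho>)"
    using assms(2) by (auto elim: landau_omega.bigE)
  then obtain R where R: "\<And>\<rho>. \<rho> \<ge> R \<Longrightarrow> C * \<rho> powr q \<le> norm (g \<rho>)"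
    by (auto simp: eventually_at_top_linorder)
  show ?thesis
  proof (rule power_lower_bound_not_in_Lp[OF C(1) assms(3,4), of "max R 1"])
    fix x :: 'a assume x: "max R 1 \<le> norm x"
    hence "x \<noteq> 0" by auto
    thus "C * norm x powr q \<le> norm (f x)"
      using R[of "norm x"] x assms(1) by simp
  qed
qed

section \<open>The Laplacian of a radial function, from partial derivatives\<close>

lemma norm_line_has_field_derivative:
  fixes x b :: "'a::euclidean_space"
  assumes "x \<noteq> 0"
  shows "((\<lambda>t. norm (x + t *\<^sub>R b)) has_field_derivative (x \<bullet> b) / norm x) (at 0)"
proof -
  have "((\<lambda>t. x + t *\<^sub>R b) has_derivative (\<lambda>t. t *\<^sub>R b)) (at 0)"
    by (auto intro!: derivative_eq_intros)
  moreover have "(norm has_derivative (\<lambda>h. h \<bullet> sgn x)) (at (x + 0 *\<^sub>R b))"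
    using has_derivative_norm[OF assms] by simp
  ultimately have "((\<lambda>t. norm (x + t *\<^sub>R b)) has_derivative (\<lambda>t. (t *\<^sub>R b) \<bullet> sgn x)) (at 0)"
    by (rule has_derivative_compose)
  moreover have "(\<lambda>t. (t *\<^sub>R b) \<bullet> sgn x) = (*) ((x \<bullet> b) / norm x)"
    by (auto simp: fun_eq_iff sgn_div_norm inner_commute divide_inverse)
  ultimately show ?thesis
    by (simp add: has_field_derivative_def)
qed

lemma partial_deriv_radial:
  fixes x b :: "'a::euclidean_space"
  assumes "x \<noteq> 0" "(S has_vector_derivative S') (at (norm x))"
  shows "partial_deriv b (radial S) x = S' * of_real ((x \<bullet> b) / norm x)"
proof -
  have "(S \<circ> (\<lambda>t. norm (x + t *\<^sub>R b)) has_vector_derivative ((x \<bullet> b) / norm x) *\<^sub>R S') (at 0)"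
    using norm_line_has_field_derivative[OF assms(1), of b] assms(2)
    by (intro vector_diff_chain_at) (simp_all add: has_real_derivative_iff_has_vector_derivative)
  thus ?thesis
    by (simp add: partial_deriv_def radial_def o_def vector_derivative_at scaleR_conv_of_real
        mult.commute)
qed

text \<open>Along the line through \<open>x\<close> in the direction of a unit vector
  \<open>b\<close>, the inner product with \<open>b\<close> is \<open>x \<bullet> b + t\<close>. The
  first partial derivative is thus an explicit product in \<open>t\<close>, to which the product and
  quotient rules apply.\<close>

lemma partial_deriv_partial_deriv_radial:
  fixes x b :: "'a::euclidean_space"
  assumes "x \<noteq> 0" "b \<in> Basis"
    and S': "\<And>\<rho>. \<rho> > 0 \<Longrightarrow> (S has_vector_derivative S' \<rho>) (at \<rho>)"
    and S'': "(S' has_vector_derivative S'') (at (norm x))"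
  shows "partial_deriv b (partial_deriv b (radial S)) x =
    S'' * of_real ((x \<bullet> b)\<^sup>2 / (norm x)\<^sup>2)
      + S' (norm x) * of_real (1 / norm x - (x \<bullet> b)\<^sup>2 / norm x ^ 3)"
proof -
  let ?N = "\<lambda>t. norm (x + t *\<^sub>R b)"
  have N: "(?N has_field_derivative (x \<bullet> b) / norm x) (at 0)"
    by (rule norm_line_has_field_derivative[OF assms(1)])
  have "((\<lambda>t. (x \<bullet> b + t) / ?N t) has_field_derivative
      1 / norm x - (x \<bullet> b)\<^sup>2 / norm x ^ 3) (at 0)"
    using assms(1)
    by (auto intro!: derivative_eq_intros N simp: field_simps power2_eq_square power3_eq_cube)
  hence "((\<lambda>t. complex_of_real ((x \<bullet> b + t) / ?N t)) has_vector_derivative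
      of_real (1 / norm x - (x \<bullet> b)\<^sup>2 / norm x ^ 3)) (at 0)"
    by (intro has_vector_derivative_of_real)
       (simp add: has_real_derivative_iff_has_vector_derivative)
  moreover have "((\<lambda>t. S' (?N t)) has_vector_derivative ((x \<bullet> b) / norm x) *\<^sub>R S'') (at 0)"
    using vector_diff_chain_at[of ?N "(x \<bullet> b) / norm x" 0 S' S''] N S''
    by (simp add: has_real_derivative_iff_has_vector_derivative o_def)
  ultimately have "((\<lambda>t. S' (?N t) * complex_of_real ((x \<bullet> b + t) / ?N t)) has_vector_derivative
      S' (?N 0) * of_real (1 / norm x - (x \<bullet> b)\<^sup>2 / norm x ^ 3)
       + ((x \<bullet> b) / norm x) *\<^sub>R S'' * complex_of_real ((x \<bullet> b + 0) / ?N 0)) (at 0)"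
    by (intro has_vector_derivative_mult)
  hence deriv: "((\<lambda>t. S' (?N t) * complex_of_real ((x \<bullet> b + t) / ?N t)) has_vector_derivative
      S'' * of_real ((x \<bullet> b)\<^sup>2 / (norm x)\<^sup>2)
        + S' (norm x) * of_real (1 / norm x - (x \<bullet> b)\<^sup>2 / norm x ^ 3)) (at 0)"
    by (simp add: scaleR_conv_of_real power2_eq_square algebra_simps)
  \<comment> \<open>The explicit form holds only while the line avoids the origin, which is an open
    condition on \<open>t\<close> satisfied at 0.\<close>
  have "((\<lambda>t. partial_deriv b (radial S) (x + t *\<^sub>R b)) has_vector_derivative
      S'' * of_real ((x \<bullet> b)\<^sup>2 / (norm x)\<^sup>2)
        + S' (norm x) * of_real (1 / norm x - (x \<bullet> b)\<^sup>2 / norm x ^ 3)) (at 0)"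
  proof (rule has_vector_derivative_transform_within_open[OF deriv])
    show "open {t. x + t *\<^sub>R b \<noteq> 0}"
      by (intro open_Collect_neq continuous_intros)
    fix t assume "t \<in> {t. x + t *\<^sub>R b \<noteq> 0}"
    thus "S' (?N t) * complex_of_real ((x \<bullet> b + t) / ?N t) = partial_deriv b (radial S) (x + t *\<^sub>R b)"
      using partial_deriv_radial[OF _ S', of "x + t *\<^sub>R b" b] assms(2)
      by (simp add: inner_add_left)
  qed (use assms in auto)
  thus ?thesis
    by (simp add: partial_deriv_def vector_derivative_at)
qed

text \<open>Summing over the basis turns the squared coordinates into
  \<open>(norm x)\<^sup>2\<close>: the coefficient of \<open>S''\<close> becomes 1, while DIM copies
  of \<open>1 / norm x\<close> lose one to the cubic term.\<close>

lemma laplacian_radial: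
  fixes x :: "'a::euclidean_space"
  assumes "x \<noteq> 0"
    and "\<And>\<rho>. \<rho> > 0 \<Longrightarrow> (S has_vector_derivative S' \<rho>) (at \<rho>)"
    and "\<And>\<rho>. \<rho> > 0 \<Longrightarrow> (S' has_vector_derivative S'' \<rho>) (at \<rho>)"
  shows "laplacian (radial S) x =
    S'' (norm x) + of_real ((real DIM('a) - 1) / norm x) * S' (norm x)"
proof -
  have sq: "(\<Sum>b\<in>Basis. (x \<bullet> b)\<^sup>2) = (norm x)\<^sup>2"
    unfolding power2_norm_eq_inner by (simp only: power2_eq_square euclidean_inner [of x x])
  have "laplacian (radial S) x = (\<Sum>b\<in>Basis. S'' (norm x) * of_real ((x \<bullet> b)\<^sup>2 / (norm x)\<^sup>2)
      + S' (norm x) * of_real (1 / norm x - (x \<bullet> b)\<^sup>2 / norm x ^ 3))"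
    unfolding laplacian_def using assms
    by (intro sum.cong partial_deriv_partial_deriv_radial) auto
  also have "\<dots> = S'' (norm x) * of_real (\<Sum>b\<in>Basis. (x \<bullet> b)\<^sup>2 / (norm x)\<^sup>2)
      + S' (norm x) * of_real (\<Sum>b\<in>Basis. 1 / norm x - (x \<bullet> b)\<^sup>2 / norm x ^ 3)"
    by (simp only: sum.distrib of_real_sum sum_distrib_left)
  also have "\<dots> = S'' (norm x) * of_real ((\<Sum>b\<in>Basis. (x \<bullet> b)\<^sup>2) / (norm x)\<^sup>2)
      + S' (norm x) * of_real (real DIM('a) / norm x - (\<Sum>b\<in>Basis. (x \<bullet> b)\<^sup>2) / norm x ^ 3)"
    by (simp add: sum_subtractf flip: sum_divide_distrib)
  also have "\<dots> = S'' (norm x) + of_real ((real DIM('a) - 1) / norm x) * S' (norm x)"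
    unfolding sq using assms(1) by (simp add: field_simps power2_eq_square power3_eq_cube)
  finally show ?thesis .
qed


section \<open>The linear system\<close>

text \<open>The balance of the fourth derivative with
  \<open>\<i> * \<kappa>^4 / 4 * \<rho> * S'\<close> forces the cube of 4/3 times the rate to equal
  \<open>\<i> * \<kappa>^4 / 4\<close>. The rates for 2, 3 and 4 are its three solutions: imaginary,
  growing and decaying.\<close>

definition wkb_rate :: "real \<Rightarrow> nat \<Rightarrow> complex" where
  "wkb_rate \<kappa> i =
     (if i = 1 then 0
      else if i = 2 then - \<i> * of_real (3 / (4 * root 3 4) * \<kappa> powr (4 / 3))
      else of_real ((if i = 3 then 1 else -1) * (3 * sqrt 3 / (8 * root 3 4) * \<kappa> powr (4 / 3)))
        + \<i> * of_real (3 / (8 * root 3 4) * \<kappa> powr (4 / 3)))"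

definition wkb_exponent :: "nat \<Rightarrow> real \<Rightarrow> real \<Rightarrow> real \<Rightarrow> nat \<Rightarrow> complex" where
  "wkb_exponent d \<sigma> \<nu> \<kappa> i =
     (if i = 1 then - of_real (2 / \<sigma>) - \<i> * of_real (4 * \<nu> / \<kappa> ^ 4)
      else of_real (- (2 / (3 * \<sigma>)) * (\<sigma> * real d - 1)) + \<i> * of_real (4 * \<nu> / (3 * \<kappa> ^ 4)))"

lemma leading_form_eq_wkb:
  assumes "\<rho> > 0" "\<kappa> > 0"
  shows "leading_form d \<sigma> \<nu> \<kappa> i \<rho> = wkb (wkb_rate \<kappa> i) (wkb_exponent d \<sigma> \<nu> \<kappa> i) \<rho>"
proof -
  have A: "complex_of_real (\<rho> powr (- (2 / (3 * \<sigma>)) * (\<sigma> * real d - 1))) =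
      exp (of_real (- (2 / (3 * \<sigma>)) * (\<sigma> * real d - 1)) * of_real (ln \<rho>))"
    using assms by (simp add: powr_def flip: exp_of_real)
  have X: "(\<kappa> * \<rho>) powr (4 / 3) = \<kappa> powr (4 / 3) * \<rho> powr (4 / 3)"
    using assms by (simp add: powr_mult)
  have P: "complex_of_real \<rho> powr w = exp (w * of_real (ln \<rho>))" for w
    using assms by (simp add: powr_def Ln_of_real)
  show ?thesis
    unfolding leading_form_def wkb_def wkb_rate_def wkb_exponent_def Let_def A X P
    by (auto simp flip: exp_add intro!: arg_cong[of _ _ exp]) (simp_all add: algebra_simps)
qed

lemma linear_system_asymp_equiv:
  assumes "linear_system d \<sigma> \<nu> \<kappa> B" "\<kappa> > 0" "i \<in> {1..4}" "k \<le> 4"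
  shows "rderiv k (B i) \<sim>[at_top] rderiv k (wkb (wkb_rate \<kappa> i) (wkb_exponent d \<sigma> \<nu> \<kappa> i))"
proof -
  have "rderiv k (B i) \<sim>[at_top] rderiv k (leading_form d \<sigma> \<nu> \<kappa> i)"
    using assms by (auto simp: linear_system_def)
  moreover have "\<forall>\<^sub>F \<rho> in at_top. rderiv k (leading_form d \<sigma> \<nu> \<kappa> i) \<rho> =
      rderiv k (wkb (wkb_rate \<kappa> i) (wkb_exponent d \<sigma> \<nu> \<kappa> i)) \<rho>"
    using eventually_gt_at_top[of 0]
    by eventually_elim (rule rderiv_cong, auto intro: leading_form_eq_wkb assms)
  ultimately show ?thesis
    by (blast intro: asymp_equiv_trans asymp_equiv_refl_ev)
qed

text \<open>Each derivative of a power gains a full factor 1/\<rho>. The lower bound also makes the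
  first solution eventually nonzero, so that it may serve as a divisor.\<close>

lemma linear_system_1_bigtheta:
  assumes "linear_system d \<sigma> \<nu> \<kappa> B" "\<kappa> > 0" "\<sigma> > 0" "k \<le> 4"
  shows "rderiv k (B 1) \<in> \<Theta>[at_top](pw (- 2 / \<sigma> - real k))"
proof -
  have "rderiv k (B 1) \<in> \<Theta>[at_top](rderiv k (wkb 0 (wkb_exponent d \<sigma> \<nu> \<kappa> 1)))"
    using linear_system_asymp_equiv[OF assms(1,2) _ assms(4), of 1]
    by (intro asymp_equiv_imp_bigtheta) (simp add: wkb_rate_def)
  also have "rderiv k (wkb 0 (wkb_exponent d \<sigma> \<nu> \<kappa> 1)) \<in> \<Theta>[at_top](pw (- 2 / \<sigma> - real k))"
    using rderiv_wkb_power_bigtheta[of "wkb_exponent d \<sigma> \<nu> \<kappa> 1" k] assms(3)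
    by (simp add: wkb_exponent_def)
  finally show ?thesis .
qed

text \<open>The rate is purely imaginary, so the solution has power size, but each differentiation
  of the fast phase may cost \<open>\<rho> powr (1/3)\<close>. For the second derivative this loss
  is exact.\<close>

lemma linear_system_2_bigtheta:
  assumes "linear_system d \<sigma> \<nu> \<kappa> B" "\<kappa> > 0"
  defines "\<alpha> \<equiv> 2 / (3 * \<sigma>) * (\<sigma> * real d - 1)"
  shows "B 2 \<in> \<Theta>[at_top](pw (- \<alpha>))" "rderiv 1 (B 2) \<in> O[at_top](pw (1 / 3 - \<alpha>))"
    "rderiv 2 (B 2) \<in> \<Theta>[at_top](pw (2 / 3 - \<alpha>))"
proof -
  let ?a = "wkb_rate \<kappa> 2" and ?b = "wkb_exponent d \<sigma> \<nu> \<kappa> 2"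
  have a: "Re ?a = 0" "?a \<noteq> 0" and b: "Re ?b = - \<alpha>"
    using assms(2) by (auto simp: wkb_rate_def wkb_exponent_def \<alpha>_def)
  have *: "rderiv k (B 2) \<in> \<Theta>[at_top](rderiv k (wkb ?a ?b))" if "k \<le> 4" for k
    using linear_system_asymp_equiv[OF assms(1,2) _ that, of 2]
    by (intro asymp_equiv_imp_bigtheta) simp
  show "B 2 \<in> \<Theta>[at_top](pw (- \<alpha>))"
    using landau_theta.trans[OF *[of 0]] wkb_bigtheta[OF a(1), of ?b] by (simp add: b)
  show "rderiv 1 (B 2) \<in> O[at_top](pw (1 / 3 - \<alpha>))"
    using landau_o.big_trans[OF bigthetaD1[OF *[of 1]] rderiv_wkb_1_bigo[OF a(1)]]
    by (simp add: b)
  show "rderiv 2 (B 2) \<in> \<Theta>[at_top](pw (2 / 3 - \<alpha>))"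
    using landau_theta.trans[OF *[of 2] rderiv_wkb_2_bigtheta[OF a]] by (simp add: b)
qed

lemma linear_system_3_at_infinity:
  assumes "linear_system d \<sigma> \<nu> \<kappa> B" "\<kappa> > 0"
  shows "filterlim (B 3) at_infinity at_top"
proof (rule asymp_equiv_at_infinity_transfer)
  show "filterlim (wkb (wkb_rate \<kappa> 3) (wkb_exponent d \<sigma> \<nu> \<kappa> 3)) at_infinity at_top"
    using assms(2) by (intro wkb_at_infinity) (simp add: wkb_rate_def)
  show "wkb (wkb_rate \<kappa> 3) (wkb_exponent d \<sigma> \<nu> \<kappa> 3) \<sim>[at_top] B 3"
    using linear_system_asymp_equiv[OF assms, of 3 0] by (simp add: asymp_equiv_sym)
qed

lemma linear_system_4_smallo:
  assumes "linear_system d \<sigma> \<nu> \<kappa> B" "\<kappa> > 0" "k \<le> 4"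
  shows "rderiv k (B 4) \<in> o[at_top](pw p)"
proof (rule landau_o.big_small_trans)
  show "rderiv k (B 4) \<in> O[at_top](rderiv k (wkb (wkb_rate \<kappa> 4) (wkb_exponent d \<sigma> \<nu> \<kappa> 4)))"
    using linear_system_asymp_equiv[OF assms(1,2) _ assms(3), of 4]
    by (intro asymp_equiv_imp_bigo) simp
  show "rderiv k (wkb (wkb_rate \<kappa> 4) (wkb_exponent d \<sigma> \<nu> \<kappa> 4)) \<in> o[at_top](pw p)"
    using assms(2) by (intro rderiv_wkb_smallo) (simp add: wkb_rate_def)
qed


section \<open>Expansions\<close>

lemma perturbed_asymp_equiv:
  fixes f e :: "real \<Rightarrow> complex"
  assumes "(e \<longlongrightarrow> 0) F"
  shows "(\<lambda>\<rho>. f \<rho> * (1 + e \<rho>)) \<sim>[F] f"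
proof (rule smallo_imp_asymp_equiv)
  have "e \<in> o[F](\<lambda>_. 1)"
    using assms by (intro smalloI_tendsto) auto
  hence "(\<lambda>\<rho>. f \<rho> * e \<rho>) \<in> o[F](\<lambda>\<rho>. f \<rho> * 1)"
    by (intro landau_o.big_small_mult) auto
  thus "(\<lambda>\<rho>. f \<rho> * (1 + e \<rho>) - f \<rho>) \<in> o[F](f)"
    by (simp add: algebra_simps)
qed

text \<open>Only terms with nonzero coefficient need a bound; once \<open>c 3\<close> vanishes, the
  growing solution is no obstacle.\<close>

lemma expansion_bigo:
  assumes "large_radius_expansion B c S" "k \<le> 4"
    and "\<And>i. i \<in> {1..4} \<Longrightarrow> c i \<noteq> 0 \<Longrightarrow> rderiv k (B i) \<in> O[at_top](g)"
  shows "rderiv k S \<in> O[at_top](g)"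
proof -
  obtain e :: "nat \<Rightarrow> real \<Rightarrow> complex" where
    e: "\<forall>\<^sub>F \<rho> in at_top. rderiv k S \<rho> = (\<Sum>i=1..4. c i * rderiv k (B i) \<rho> * (1 + e i \<rho>))"
       "\<forall>i\<in>{1..4}. (e i \<longlongrightarrow> 0) at_top"
    using assms(1,2) unfolding large_radius_expansion_def by blast
  have "(\<lambda>\<rho>. c i * rderiv k (B i) \<rho> * (1 + e i \<rho>)) \<in> O[at_top](g)" if "i \<in> {1..4}" for i
  proof (cases "c i = 0")
    case False
    have "(\<lambda>\<rho>. c i * rderiv k (B i) \<rho> * (1 + e i \<rho>)) \<in> O[at_top](\<lambda>\<rho>. c i * rderiv k (B i) \<rho>)"
      using e(2) that by (intro asymp_equiv_imp_bigo perturbed_asymp_equiv) auto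
    also have "(\<lambda>\<rho>. c i * rderiv k (B i) \<rho>) \<in> O[at_top](g)"
      using assms(3)[OF that False] by simp
    finally show ?thesis .
  qed simp
  hence "(\<lambda>\<rho>. \<Sum>i=1..4. c i * rderiv k (B i) \<rho> * (1 + e i \<rho>)) \<in> O[at_top](g)"
    by (intro big_sum_in_bigo)
  thus ?thesis
    using e(1) landau_o.big.in_cong by fastforce
qed

text \<open>Term \<open>j\<close> differs from its unperturbed form by o(1) times a quantity of size
  \<open>g\<close>, and every other term that is present is small by assumption.\<close>

lemma expansion_dominant:
  assumes "large_radius_expansion B c S" "k \<le> 4" "j \<in> {1..4}"
    and "rderiv k (B j) \<in> O[at_top](g)"
    and "\<And>i. i \<in> {1..4} \<Longrightarrow> i \<noteq> j \<Longrightarrow> c i \<noteq> 0 \<Longrightarrow> rderiv k (B i) \<in> o[at_top](g)"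
  shows "(\<lambda>\<rho>. rderiv k S \<rho> - c j * rderiv k (B j) \<rho>) \<in> o[at_top](g)"
proof -
  obtain e :: "nat \<Rightarrow> real \<Rightarrow> complex" where
    e: "\<forall>\<^sub>F \<rho> in at_top. rderiv k S \<rho> = (\<Sum>i=1..4. c i * rderiv k (B i) \<rho> * (1 + e i \<rho>))"
       "\<forall>i\<in>{1..4}. (e i \<longlongrightarrow> 0) at_top"
    using assms(1,2) unfolding large_radius_expansion_def by blast
  let ?T = "\<lambda>i \<rho>. c i * rderiv k (B i) \<rho> * (1 + e i \<rho>)"
  have "?T i \<in> o[at_top](g)" if "i \<in> {1..4} - {j}" for i
  proof (cases "c i = 0")
    case False
    have "?T i \<in> O[at_top](\<lambda>\<rho>. c i * rderiv k (B i) \<rho>)"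
      using e(2) that by (intro asymp_equiv_imp_bigo perturbed_asymp_equiv) auto
    also have "(\<lambda>\<rho>. c i * rderiv k (B i) \<rho>) \<in> o[at_top](g)"
      using assms(5)[of i] that False by simp
    finally show ?thesis .
  qed simp
  hence "(\<lambda>\<rho>. \<Sum>i\<in>{1..4} - {j}. ?T i \<rho>) \<in> o[at_top](g)"
    by (intro big_sum_in_smallo)
  moreover have "(\<lambda>\<rho>. ?T j \<rho> - c j * rderiv k (B j) \<rho>) \<in> o[at_top](g)"
  proof -
    have "(\<lambda>\<rho>. ?T j \<rho> - c j * rderiv k (B j) \<rho>) \<in> o[at_top](\<lambda>\<rho>. c j * rderiv k (B j) \<rho>)"
      using e(2) assms(3) by (intro asymp_equiv_imp_diff_smallo perturbed_asymp_equiv) auto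
    also have "(\<lambda>\<rho>. c j * rderiv k (B j) \<rho>) \<in> O[at_top](g)"
      using assms(4) by (cases "c j = 0") auto
    finally show ?thesis .
  qed
  ultimately have "(\<lambda>\<rho>. (\<Sum>i\<in>{1..4} - {j}. ?T i \<rho>) + (?T j \<rho> - c j * rderiv k (B j) \<rho>)) \<in> o[at_top](g)"
    by (rule sum_in_smallo)
  moreover have "\<forall>\<^sub>F \<rho> in at_top. (\<Sum>i\<in>{1..4} - {j}. ?T i \<rho>) + (?T j \<rho> - c j * rderiv k (B j) \<rho>) =
      rderiv k S \<rho> - c j * rderiv k (B j) \<rho>"
    using e(1) by eventually_elim (use assms(3) in \<open>simp add: sum.remove[of _ j]\<close>)
  ultimately show ?thesis
    by (rule landau_o.small.in_cong[THEN iffD1, rotated])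
qed

text \<open>The fourth term is absorbed into the relative correction of the first: their quotient
  \<open>e1\<close> is exponentially small, hence compatible with the required decay of order
  4.\<close>

lemma expansion_drop_4:
  assumes exp: "large_radius_expansion B c S"
    and sys: "linear_system d \<sigma> \<nu> \<kappa> B" "\<kappa> > 0" "\<sigma> > 0"
    and c: "c 1 \<noteq> 0" "c 2 = 0" "c 3 = 0"
  shows "large_radius_expansion B (\<lambda>i. if i = 1 then c 1 else 0) S"
  unfolding large_radius_expansion_def
proof (intro allI impI)
  fix k :: nat assume k: "k \<le> 4"
  have sum4: "(\<Sum>i=1..4. f i) = f 1 + f 2 + f 3 + f 4" for f :: "nat \<Rightarrow> complex"
    by (simp add: numeral_eq_Suc)
  obtain e :: "nat \<Rightarrow> real \<Rightarrow> complex" where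
    e: "\<forall>\<^sub>F \<rho> in at_top. rderiv k S \<rho> = (\<Sum>i=1..4. c i * rderiv k (B i) \<rho> * (1 + e i \<rho>))"
       "\<forall>i\<in>{1..4}. (e i \<longlongrightarrow> 0) at_top" "e 1 \<in> O[at_top](\<lambda>\<rho>. of_real (1 / \<rho>^4))"
    using exp k unfolding large_radius_expansion_def by blast
  define e1 where "e1 = (\<lambda>\<rho>. c 4 * rderiv k (B 4) \<rho> * (1 + e 4 \<rho>) / (c 1 * rderiv k (B 1) \<rho>))"
  have B1: "rderiv k (B 1) \<in> \<Theta>[at_top](pw (- 2 / \<sigma> - real k))"
    using linear_system_1_bigtheta[OF sys k] .
  have ev_pw: "\<forall>\<^sub>F \<rho> in at_top. pw p \<rho> \<noteq> 0" for p
    using eventually_gt_at_top[of 0] by eventually_elim (auto simp: pw_def)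
  have B1_nz: "\<forall>\<^sub>F \<rho> in at_top. rderiv k (B 1) \<rho> \<noteq> 0"
    using eventually_nonzero_bigtheta[OF B1] ev_pw by blast
  have pw4: "\<forall>\<^sub>F \<rho> in at_top. pw (- 4) \<rho> = of_real (1 / \<rho> ^ 4)"
    using eventually_gt_at_top[of 0]
    by eventually_elim (simp add: pw_def powr_minus divide_inverse)
  have "(\<lambda>\<rho>. c 4 * rderiv k (B 4) \<rho> * (1 + e 4 \<rho>)) \<in> O[at_top](\<lambda>\<rho>. c 4 * rderiv k (B 4) \<rho>)"
    using e(2) by (intro asymp_equiv_imp_bigo perturbed_asymp_equiv) auto
  \<comment> \<open>The fourth solution lies below every power; this one is chosen so that dividing
    by the size of the first solution leaves order -4.\<close>
  also have "(\<lambda>\<rho>. c 4 * rderiv k (B 4) \<rho>) \<in> O[at_top](pw (- 2 / \<sigma> - real k - 4))"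
    using landau_o.small_imp_big[OF linear_system_4_smallo[OF sys(1,2) k]]
    by (cases "c 4 = 0") auto
  finally have "e1 \<in> O[at_top](\<lambda>\<rho>. pw (- 2 / \<sigma> - real k - 4) \<rho> / pw (- 2 / \<sigma> - real k) \<rho>)"
    unfolding e1_def using B1 c(1) B1_nz ev_pw
    by (intro landau_o.big.divide) (auto simp: bigtheta_def bigomega_iff_bigo)
  also have "\<forall>\<^sub>F \<rho> in at_top. pw (- 2 / \<sigma> - real k - 4) \<rho> / pw (- 2 / \<sigma> - real k) \<rho> = pw (-4) \<rho>"
    using eventually_gt_at_top[of 0] by eventually_elim (simp add: pw_divide)
  finally have e1: "e1 \<in> O[at_top](pw (-4))" .
  have e1_sum: "(\<lambda>\<rho>. e 1 \<rho> + e1 \<rho>) \<in> O[at_top](\<lambda>\<rho>. of_real (1 / \<rho>^4))"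
    using e(3) e1 landau_o.big.cong[OF pw4] by (intro sum_in_bigo) auto
  have "(e1 \<longlongrightarrow> 0) at_top"
    using bigo_pw_tendsto_0[OF e1] by simp
  hence lim: "((\<lambda>\<rho>. e 1 \<rho> + e1 \<rho>) \<longlongrightarrow> 0) at_top"
    using tendsto_add[of "e 1" 0 at_top e1 0] e(2) by auto
  show "\<exists>e. (\<forall>\<^sub>F \<rho> in at_top. rderiv k S \<rho> =
            (\<Sum>i=1..4. (if i = 1 then c 1 else 0) * rderiv k (B i) \<rho> * (1 + e i \<rho>))) \<and>
          (\<forall>i\<in>{1..4}. (e i \<longlongrightarrow> 0) at_top) \<and> e 1 \<in> O[at_top](\<lambda>\<rho>. of_real (1 / \<rho>^4))"
  proof (intro exI[of _ "\<lambda>i. if i = 1 then (\<lambda>\<rho>. e 1 \<rho> + e1 \<rho>) else (\<lambda>_. 0)"] conjI)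
    show "\<forall>\<^sub>F \<rho> in at_top. rderiv k S \<rho> = (\<Sum>i=1..4. (if i = 1 then c 1 else 0) *
        rderiv k (B i) \<rho> * (1 + (if i = 1 then (\<lambda>\<rho>. e 1 \<rho> + e1 \<rho>) else (\<lambda>_. 0)) \<rho>))"
      using e(1) B1_nz
    proof eventually_elim
      case (elim \<rho>)
      have "c 1 * rderiv k (B 1) \<rho> * e1 \<rho> = c 4 * rderiv k (B 4) \<rho> * (1 + e 4 \<rho>)"
        using elim(2) c(1) by (simp add: e1_def)
      thus ?case
        using elim(1) c unfolding sum4 by (simp add: algebra_simps)
    qed
  qed (use e1_sum lim in auto)
qed

section \<open>The equation as a first-order relation at infinity\<close>

text \<open>The equation itself expresses \<open>\<rho> S' + (2/\<sigma> + 4 i \<nu>/\<kappa>^4) S\<close> through \<open>\<Delta>\<^sup>2 S\<close> and the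
  nonlinear term, both of which are four orders smaller than \<open>S\<close>.\<close>

lemma profile_solution_first_order:
  assumes "profile_solution d \<sigma> \<nu> \<kappa> S" "\<kappa> > 0" "\<rho> > 0"
  shows "of_real \<rho> * rderiv 1 S \<rho> + (of_real (2 / \<sigma>) + \<i> * of_real (4 * \<nu> / \<kappa>^4)) * S \<rho> =
    - \<i> * of_real (4 / \<kappa>^4) *
      (bilaplace_radial d S \<rho> - of_real (cmod (S \<rho>) powr (2 * \<sigma>)) * S \<rho>)"
proof -
  have "linear_part d \<sigma> \<nu> \<kappa> S \<rho> + of_real (cmod (S \<rho>) powr (2 * \<sigma>)) * S \<rho> = 0"
    using assms by (simp add: profile_solution_def)
  hence eq: "bilaplace_radial d S \<rho> - of_real (cmod (S \<rho>) powr (2 * \<sigma>)) * S \<rho> =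
     - of_real \<nu> * S \<rho>
     + \<i> * of_real (\<kappa>^4 / 4) * (of_real (2 / \<sigma>) * S \<rho> + of_real \<rho> * rderiv 1 S \<rho>)"
    by (simp add: linear_part_def algebra_simps)
  \<comment> \<open>The factor \<open>- \<i> * (4 / K)\<close> normalises the coefficient of
    \<open>y\<close> to 1 and turns \<open>- n\<close> into \<open>\<i> * (4 * n / K)\<close>. It is
    used with \<open>K\<close> the fourth power of \<kappa> and \<open>y\<close> the product of
    \<rho> and the first derivative.\<close>
  have solve: "- \<i> * (4 / K) * (- n * s + \<i> * (K / 4) * (z * s + y)) = y + (z + \<i> * (4 * n / K)) * s"
    if "K \<noteq> 0" for K n s z y :: complex
    using that by (simp add: field_simps)
  show ?thesis
    unfolding eq
    using assms(2) solve[of "of_real \<kappa> ^ 4" "of_real \<nu>" "S \<rho>" "of_real (2 / \<sigma>)" "of_real \<rho> * rderiv 1 S \<rho>"]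
    by simp
qed

lemma bigo_powr_nonlinearity:
  assumes "S \<in> O[at_top](pw q)" "\<sigma> \<ge> 0"
  shows "(\<lambda>\<rho>. of_real (cmod (S \<rho>) powr (2 * \<sigma>)) * S \<rho>) \<in> O[at_top](pw (2 * \<sigma> * q + q))"
proof (rule bigo_pw_mult[OF _ assms(1)])
  obtain C where C: "C > 0" "\<forall>\<^sub>F \<rho> in at_top. norm (S \<rho>) \<le> C * norm (pw q \<rho>)"
    using assms(1) by (auto elim: landau_o.bigE)
  have "\<forall>\<^sub>F \<rho> in at_top. norm (complex_of_real (cmod (S \<rho>) powr (2 * \<sigma>))) \<le>
      C powr (2 * \<sigma>) * norm (pw (2 * \<sigma> * q) \<rho>)"
    using C(2) eventually_gt_at_top[of 0]
  proof eventually_elim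
    case (elim \<rho>)
    have "cmod (S \<rho>) powr (2 * \<sigma>) \<le> (C * \<rho> powr q) powr (2 * \<sigma>)"
      using elim assms(2) by (intro powr_mono2) auto
    also have "\<dots> = C powr (2 * \<sigma>) * \<rho> powr (2 * \<sigma> * q)"
      using C(1) by (simp add: powr_mult powr_powr mult.commute)
    finally show ?case by simp
  qed
  thus "(\<lambda>\<rho>. complex_of_real (cmod (S \<rho>) powr (2 * \<sigma>))) \<in> O[at_top](pw (2 * \<sigma> * q))"
    by (rule bigoI)
qed

lemma bigo_pw_divide_power:
  assumes "f \<in> O[at_top](pw q)"
  shows "(\<lambda>\<rho>. (a / \<rho> ^ n) *\<^sub>R f \<rho>) \<in> O[at_top](pw (q - real n))"
proof -
  have "(\<lambda>\<rho>. complex_of_real (a / \<rho> ^ n)) \<in> O[at_top](pw (- real n))"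
    by (rule bigoI[of _ "\<bar>a\<bar>"], rule eventually_mono[OF eventually_gt_at_top[of 0]])
       (simp add: powr_minus powr_realpow norm_divide norm_power divide_inverse norm_mult
          norm_inverse)
  from bigo_pw_mult[OF this assms] show ?thesis
    by (simp add: scaleR_conv_of_real)
qed

text \<open>In every term the order of the derivative and the power of 1/\<rho> add up to 4.\<close>

lemma bilaplace_radial_bigo:
  assumes "\<And>k. k \<le> 4 \<Longrightarrow> rderiv k S \<in> O[at_top](pw (q - real k))"
  shows "bilaplace_radial d S \<in> O[at_top](pw (q - 4))"
proof -
  have "(\<lambda>\<rho>. rderiv 4 S \<rho>
     + (2 * (real d - 1) / \<rho> ^ 1) *\<^sub>R rderiv 3 S \<rho>
     + ((real d - 1) * (real d - 3) / \<rho>^2) *\<^sub>R rderiv 2 S \<rho>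
     - ((real d - 1) * (real d - 3) / \<rho>^3) *\<^sub>R rderiv 1 S \<rho>) \<in> O[at_top](pw (q - 4))"
    using assms[of 4] bigo_pw_divide_power[OF assms[of 3], of "2 * (real d - 1)" 1]
      bigo_pw_divide_power[OF assms[of 2], of "(real d - 1) * (real d - 3)" 2]
      bigo_pw_divide_power[OF assms[of 1], of "(real d - 1) * (real d - 3)" 3]
    by (intro sum_in_bigo) auto
  thus ?thesis
    by (simp add: bilaplace_radial_def [abs_def])
qed


section \<open>Vanishing of the growing and oscillating coefficients\<close>

lemma expansion_growing_coefficient_0:
  assumes "large_radius_expansion B c S" "linear_system d \<sigma> \<nu> \<kappa> B"
    and "\<kappa> > 0" "\<sigma> > 0" "\<sigma> * real d > 1" "(S \<longlongrightarrow> 0) at_top"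
  shows "c 3 = 0"
proof (rule ccontr)
  assume c3: "c 3 \<noteq> 0"
  have B3: "filterlim (B 3) at_infinity at_top"
    by (rule linear_system_3_at_infinity[OF assms(2,3)])
  hence one: "(\<lambda>_. 1) \<in> o[at_top](B 3)"
    by (simp add: smallomega_iff_smallo [symmetric] smallomega_1_conv_filterlim)
  have small: "f \<in> o[at_top](B 3)" if "f \<in> O[at_top](pw p)" "p < 0" for f p
  proof -
    have "f \<in> o[at_top](\<lambda>_. 1)"
      using bigo_pw_tendsto_0[OF that] by (intro smalloI_tendsto) auto
    thus ?thesis
      using one landau_o.small_trans by blast
  qed
  have "B 1 \<in> o[at_top](B 3)"
    using linear_system_1_bigtheta[OF assms(2-4), of 0] assms(4)
    by (intro small[of _ "- 2 / \<sigma>"]) (auto simp: bigtheta_def)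
  moreover have "B 2 \<in> o[at_top](B 3)"
    \<comment> \<open>The oscillating solution decays because \<sigma> d exceeds 1.\<close>
    using linear_system_2_bigtheta(1)[OF assms(2,3)] assms(4,5)
    by (intro small[of _ "- (2 / (3 * \<sigma>) * (\<sigma> * real d - 1))"]) (auto simp: bigtheta_def)
  moreover have "B 4 \<in> o[at_top](B 3)"
    using landau_o.small_imp_big[OF linear_system_4_smallo[OF assms(2,3), of 0 "-1"]]
    by (intro small[of _ "-1"]) auto
  ultimately have "(\<lambda>\<rho>. S \<rho> - c 3 * B 3 \<rho>) \<in> o[at_top](B 3)"
    using expansion_dominant[OF assms(1), of 0 3 "B 3"]
    by (auto simp: atLeastAtMost_def atMost_def atLeast_def numeral_eq_Suc le_Suc_eq)
  hence "S \<sim>[at_top] (\<lambda>\<rho>. c 3 * B 3 \<rho>)"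
    using c3 by (intro smallo_imp_asymp_equiv) simp
  hence "B 3 \<in> O[at_top](S)"
    using c3 by (auto dest: asymp_equiv_imp_bigtheta simp: bigtheta_def bigomega_iff_bigo)
  moreover have "S \<in> o[at_top](\<lambda>_. 1)"
    using assms(6) by (intro smalloI_tendsto) auto
  \<comment> \<open>The chain is: \<open>B 3\<close> is O(S), S is o(1), and 1 is o of
    \<open>B 3\<close>. A function negligible against itself is eventually zero.\<close>
  ultimately have "B 3 \<in> o[at_top](B 3)"
    using one by (meson landau_o.big_small_trans landau_o.small_trans)
  hence "\<forall>\<^sub>F \<rho> in at_top. B 3 \<rho> = 0"
    by (simp add: landau_o.small_refl_iff)
  moreover have "\<forall>\<^sub>F \<rho> in at_top. B 3 \<rho> \<noteq> 0"
    using B3 by (rule filterlim_at_infinity_imp_eventually_ne)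
  ultimately have "\<forall>\<^sub>F \<rho>::real in at_top. False"
    by eventually_elim simp
  thus False by simp
qed

text \<open>The Laplacian separates the two power-size solutions: two derivatives enlarge the
  oscillating one by \<open>\<rho> powr (2/3)\<close> and shrink the first one by
  \<open>\<rho> powr (-2)\<close>.\<close>

lemma expansion_oscillating_coefficient_0:
  fixes u :: "'a::euclidean_space \<Rightarrow> complex"
  assumes exp: "large_radius_expansion B c S"
    and sys: "linear_system d \<sigma> \<nu> \<kappa> B" "\<kappa> > 0" "\<sigma> > 0"
    and d: "d = DIM('a)" "d > 4 \<Longrightarrow> \<sigma> < 4 / (real d - 4)"
    and c3: "c 3 = 0"
    and diff: "\<And>k \<rho>. k < 3 \<Longrightarrow> \<rho> > 0 \<Longrightarrow> rderiv k S differentiable (at \<rho> within {0..})"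
    and L2: "laplacian (radial S :: 'a \<Rightarrow> complex) \<in> Lp 2"
  shows "c 2 = 0"
proof (rule ccontr)
  assume c2: "c 2 \<noteq> 0"
  \<comment> \<open>The exponent of the second derivative of the oscillating solution.\<close>
  define \<beta> where "\<beta> = 2 / 3 - 2 / (3 * \<sigma>) * (\<sigma> * real d - 1)"
  have \<beta>: "\<beta> = 2 / 3 * (1 + 1 / \<sigma> - real d)"
    using sys(3) by (simp add: \<beta>_def field_simps)
  \<comment> \<open>For \<open>d > 4\<close> this is the upper bound on \<sigma>; in lower
    dimensions the left side is at most 0.\<close>
  have crit: "real d - 4 < 4 / \<sigma>"
  proof (cases "d > 4")
    case True
    thus ?thesis using d(2) sys(3) by (simp add: field_simps)
  next
    case False
    hence "real d - 4 \<le> 0" by simp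
    also have "0 < 4 / \<sigma>" using sys(3) by simp
    finally show ?thesis .
  qed
  note B2 = linear_system_2_bigtheta[OF sys(1,2)]
  have B1: "rderiv k (B 1) \<in> O[at_top](pw (- 2 / \<sigma> - real k))" if "k \<le> 4" for k
    using linear_system_1_bigtheta[OF sys that] by (rule bigthetaD1)
  have B4: "rderiv k (B 4) \<in> o[at_top](pw p)" if "k \<le> 4" for k p
    by (rule linear_system_4_smallo[OF sys(1,2) that])
  have cases4: "i = 1 \<or> i = 2 \<or> i = 3 \<or> i = 4" if "i \<in> {1..4}" for i :: nat
    using that by auto
  have S2: "(\<lambda>\<rho>. rderiv 2 S \<rho> - c 2 * rderiv 2 (B 2) \<rho>) \<in> o[at_top](pw \<beta>)"
  proof (rule expansion_dominant[OF exp])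
    show "rderiv 2 (B 2) \<in> O[at_top](pw \<beta>)"
      using B2(3) by (simp add: \<beta>_def bigtheta_def)
    fix i :: nat assume i: "i \<in> {1..4}" "i \<noteq> 2" "c i \<noteq> 0"
    have "rderiv 2 (B 1) \<in> o[at_top](pw \<beta>)"
      using crit by (intro landau_o.big_small_trans[OF B1 pw_smallo]) (simp_all add: \<beta>)
    moreover have "rderiv 2 (B 4) \<in> o[at_top](pw \<beta>)"
      by (rule B4) simp
    ultimately show "rderiv 2 (B i) \<in> o[at_top](pw \<beta>)"
      using cases4[OF i(1)] i(2,3) c3 by auto
  qed simp_all
  \<comment> \<open>The larger of the exponents of the first derivatives of the oscillating and of
    the first solution. After division by \<rho> both fall below \<beta>, by 4/3 in the oscillating
    case and through \<open>crit\<close> in the other.\<close>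
  define m where "m = max (\<beta> - 1 / 3) (- 2 / \<sigma> - 1)"
  have "rderiv 1 (B i) \<in> O[at_top](pw m)" if "i \<in> {1..4}" "c i \<noteq> 0" for i
  proof -
    have "rderiv 1 (B 1) \<in> O[at_top](pw m)"
      using landau_o.big_trans[OF B1[of 1] pw_bigo[of _ m]] by (simp add: m_def)
    moreover have "rderiv 1 (B 2) \<in> O[at_top](pw m)"
      using landau_o.big_trans[OF B2(2) pw_bigo[of _ m]] by (simp add: m_def \<beta>_def)
    moreover have "rderiv 1 (B 4) \<in> O[at_top](pw m)"
      using landau_o.small_imp_big[OF B4[of 1]] by simp
    ultimately show ?thesis
      using cases4[OF that(1)] that(2) c3 by auto
  qed
  hence "rderiv 1 S \<in> O[at_top](pw m)"
    by (intro expansion_bigo[OF exp]) auto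
  from bigo_pw_divide_power[OF this, of "real d - 1" 1]
  have "(\<lambda>\<rho>. of_real ((real d - 1) / \<rho>) * rderiv 1 S \<rho>) \<in> O[at_top](pw (m - 1))"
    by (simp add: scaleR_conv_of_real)
  also have "pw (m - 1) \<in> o[at_top](pw \<beta>)"
  proof (rule pw_smallo)
    have "- 2 / \<sigma> - 1 - 1 < \<beta>"
      using crit by (simp add: \<beta>)
    thus "m - 1 < \<beta>"
      by (auto simp: m_def max_def)
  qed
  finally have "(\<lambda>\<rho>. (rderiv 2 S \<rho> - c 2 * rderiv 2 (B 2) \<rho>) +
      of_real ((real d - 1) / \<rho>) * rderiv 1 S \<rho>) \<in> o[at_top](pw \<beta>)"
    by (intro sum_in_smallo S2)
  also have "pw \<beta> \<in> O[at_top](\<lambda>\<rho>. c 2 * rderiv 2 (B 2) \<rho>)"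
    using B2(3) c2 by (simp add: \<beta>_def bigtheta_def bigomega_iff_bigo)
  finally have "(\<lambda>\<rho>. rderiv 2 S \<rho> + of_real ((real d - 1) / \<rho>) * rderiv 1 S \<rho>)
      \<sim>[at_top] (\<lambda>\<rho>. c 2 * rderiv 2 (B 2) \<rho>)"
    by (intro smallo_imp_asymp_equiv) (simp add: algebra_simps)
  hence "(\<lambda>\<rho>. rderiv 2 S \<rho> + of_real ((real d - 1) / \<rho>) * rderiv 1 S \<rho>)
      \<in> \<Theta>[at_top](\<lambda>\<rho>. c 2 * rderiv 2 (B 2) \<rho>)"
    by (rule asymp_equiv_imp_bigtheta)
  also have "(\<lambda>\<rho>. c 2 * rderiv 2 (B 2) \<rho>) \<in> \<Theta>[at_top](pw \<beta>)"
    using B2(3) c2 by (simp add: \<beta>_def)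
  finally have "(\<lambda>\<rho>. rderiv 2 S \<rho> + of_real ((real d - 1) / \<rho>) * rderiv 1 S \<rho>) \<in> \<Omega>[at_top](pw \<beta>)"
    by (rule bigthetaD2)
  moreover have "laplacian (radial S) x =
      rderiv 2 S (norm x) + of_real ((real d - 1) / norm x) * rderiv 1 S (norm x)"
    if "x \<noteq> 0" for x :: 'a
    unfolding d(1)
  proof (rule laplacian_radial[OF that])
    fix \<rho> :: real assume \<rho>: "\<rho> > 0"
    show "(S has_vector_derivative rderiv 1 S \<rho>) (at \<rho>)"
      using rderiv_Suc_has_vector_derivative[OF \<rho> diff[OF _ \<rho>], of 0] by simp
    show "(rderiv 1 S has_vector_derivative rderiv 2 S \<rho>) (at \<rho>)"
      using rderiv_Suc_has_vector_derivative[OF \<rho> diff[OF _ \<rho>], of 1]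
      by (simp add: numeral_2_eq_2)
  qed
  \<comment> \<open>Multiplied out, this is d - 4 at most 4/\<sigma>, so \<open>crit\<close> places
    the Laplacian beyond the threshold of square integrability.\<close>
  moreover have "2 * \<beta> \<ge> - real DIM('a)"
    using crit unfolding \<beta> d(1) [symmetric] by simp
  ultimately have "laplacian (radial S :: 'a \<Rightarrow> complex) \<notin> Lp 2"
    by (intro radial_not_in_Lp) auto
  with L2 show False by blast
qed

section \<open>Asymptotics and non-integrability of the profile\<close>

theorem lemma8:
  fixes d :: nat and \<sigma> \<nu> \<kappa> :: real
    and S :: "real \<Rightarrow> complex" and u :: "real ^ 'd \<Rightarrow> complex"
    and B :: "nat \<Rightarrow> real \<Rightarrow> complex" and c :: "nat \<Rightarrow> complex"
  assumes d: "d = CARD('d)"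
    and sigma_lower: "\<sigma> > 4 / real d"
    and sigma_upper: "d > 4 \<Longrightarrow> \<sigma> < 4 / (real d - 4)"
    and kappa: "\<kappa> > 0"
    and sol: "profile_solution d \<sigma> \<nu> \<kappa> S"
    and u: "u = radial S"
    and finite_H: "laplacian u \<in> Lp 2" "u \<in> Lp (2 * \<sigma> + 2)"
    and zero_H: "Hamiltonian \<sigma> u = 0"
    and B: "linear_system d \<sigma> \<nu> \<kappa> B"
    and expansion: "large_radius_expansion B c S"
  shows "c 2 = 0 \<and> c 3 = 0 \<and>
    (c 1 \<noteq> 0 \<longrightarrow>
       S \<sim>[at_top] (\<lambda>\<rho>. c 1 * B 1 \<rho>) \<and>
       large_radius_expansion B (\<lambda>i. if i = 1 then c 1 else 0) S \<and>
       (\<forall>\<gamma>. 2 / 3 * (real d - 2 - 2 / \<sigma>) < \<gamma> \<and> \<gamma> < 4 + 2 / \<sigma> \<longrightarrow>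
          ((\<lambda>\<rho>. (of_real \<rho> * rderiv 1 S \<rho>
                 + (of_real (2 / \<sigma>) + \<i> * of_real (4 * \<nu> / \<kappa>^4)) * S \<rho>) * of_real (\<rho> powr \<gamma>))
            \<longlongrightarrow> 0) at_top) \<and>
       u \<in> Lp (2 * \<sigma> + 2) \<and> u \<notin> Lp 2)"
proof -
  have "CARD('d) > 0" by simp
  hence d_pos: "d > 0" using d by simp
  have "0 < 4 / real d" using d_pos by simp
  hence \<sigma>: "\<sigma> > 0" using sigma_lower by linarith
  have \<sigma>d: "\<sigma> * real d > 4"
    using sigma_lower d_pos by (simp add: field_simps)
  have c3: "c 3 = 0"
    using sol \<sigma>d by (intro expansion_growing_coefficient_0[OF expansion B kappa \<sigma>])
      (auto simp: profile_solution_def)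
  have c2: "c 2 = 0"
    using sol d sigma_upper c3 finite_H(1) u
    by (intro expansion_oscillating_coefficient_0[OF expansion B kappa \<sigma>, where 'a = "real ^ 'd"])
      (auto simp: profile_solution_def)
  have main: "S \<sim>[at_top] (\<lambda>\<rho>. c 1 * B 1 \<rho>) \<and>
       large_radius_expansion B (\<lambda>i. if i = 1 then c 1 else 0) S \<and>
       (\<forall>\<gamma>. 2 / 3 * (real d - 2 - 2 / \<sigma>) < \<gamma> \<and> \<gamma> < 4 + 2 / \<sigma> \<longrightarrow>
          ((\<lambda>\<rho>. (of_real \<rho> * rderiv 1 S \<rho>
                 + (of_real (2 / \<sigma>) + \<i> * of_real (4 * \<nu> / \<kappa>^4)) * S \<rho>) * of_real (\<rho> powr \<gamma>))
            \<longlongrightarrow> 0) at_top) \<and>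
       u \<in> Lp (2 * \<sigma> + 2) \<and> u \<notin> Lp 2" if c1: "c 1 \<noteq> 0"
  proof (intro conjI allI impI)
    show exp1: "large_radius_expansion B (\<lambda>i. if i = 1 then c 1 else 0) S"
      by (rule expansion_drop_4[OF expansion B kappa \<sigma> c1 c2 c3])
    have B1: "rderiv k (B 1) \<in> \<Theta>[at_top](pw (- 2 / \<sigma> - real k))" if "k \<le> 4" for k
      by (rule linear_system_1_bigtheta[OF B kappa \<sigma> that])
    \<comment> \<open>In the truncated expansion all other coefficients vanish, so
      \<open>B 1\<close> can be compared with itself without bounds on the remaining
      solutions.\<close>
    have "(\<lambda>\<rho>. rderiv 0 S \<rho> - (if 1 = (1::nat) then c 1 else 0) * rderiv 0 (B 1) \<rho>)
        \<in> o[at_top](B 1)"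
      by (rule expansion_dominant[OF exp1]) (auto split: if_splits)
    thus equiv: "S \<sim>[at_top] (\<lambda>\<rho>. c 1 * B 1 \<rho>)"
      using c1 by (intro smallo_imp_asymp_equiv) simp
    have S_k: "rderiv k S \<in> O[at_top](pw (- 2 / \<sigma> - real k))" if "k \<le> 4" for k
      using B1[OF that]
      by (intro expansion_bigo[OF exp1 that]) (auto simp: bigtheta_def split: if_splits)
    show "((\<lambda>\<rho>. (of_real \<rho> * rderiv 1 S \<rho>
                 + (of_real (2 / \<sigma>) + \<i> * of_real (4 * \<nu> / \<kappa>^4)) * S \<rho>) * of_real (\<rho> powr \<gamma>))
            \<longlongrightarrow> 0) at_top"
      if \<gamma>: "2 / 3 * (real d - 2 - 2 / \<sigma>) < \<gamma> \<and> \<gamma> < 4 + 2 / \<sigma>" for \<gamma>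
    proof -
      let ?N = "\<lambda>\<rho>. of_real (cmod (S \<rho>) powr (2 * \<sigma>)) * S \<rho>"
      \<comment> \<open>At the decay rate -2/\<sigma> the factor
        \<open>cmod (S \<rho>) powr (2 * \<sigma>)\<close> contributes exactly order -4, the same
        gain as the bilaplacian.\<close>
      have eq: "2 * \<sigma> * (- 2 / \<sigma>) + - 2 / \<sigma> = - 2 / \<sigma> - 4"
        using \<sigma> by simp
      have "S \<in> O[at_top](pw (- 2 / \<sigma>))"
        using S_k[of 0] by simp
      from bigo_powr_nonlinearity[OF this, of \<sigma>] have "?N \<in> O[at_top](pw (- 2 / \<sigma> - 4))"
        unfolding eq using \<sigma> by simp
      hence "(\<lambda>\<rho>. - \<i> * of_real (4 / \<kappa>^4) * (bilaplace_radial d S \<rho> - ?N \<rho>))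
          \<in> O[at_top](pw (- 2 / \<sigma> - 4))"
        using bilaplace_radial_bigo[OF S_k] kappa by (simp add: sum_in_bigo)
      from bigo_pw_mult[OF this, of "pw \<gamma>" \<gamma>]
      have "((\<lambda>\<rho>. - \<i> * of_real (4 / \<kappa>^4) * (bilaplace_radial d S \<rho> - ?N \<rho>) * pw \<gamma> \<rho>) \<longlongrightarrow> 0) at_top"
        \<comment> \<open>The total exponent is negative exactly when \<gamma> is below 4 +
          2/\<sigma>.\<close>
        using \<gamma> by (intro bigo_pw_tendsto_0[of _ "- 2 / \<sigma> - 4 + \<gamma>"]) auto
      moreover have "\<forall>\<^sub>F \<rho> in at_top.
          - \<i> * of_real (4 / \<kappa>^4) * (bilaplace_radial d S \<rho> - ?N \<rho>) * pw \<gamma> \<rho> =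
          (of_real \<rho> * rderiv 1 S \<rho>
                 + (of_real (2 / \<sigma>) + \<i> * of_real (4 * \<nu> / \<kappa>^4)) * S \<rho>) * of_real (\<rho> powr \<gamma>)"
        using eventually_gt_at_top[of 0]
        by eventually_elim (simp only: profile_solution_first_order[OF sol kappa] pw_def)
      ultimately show ?thesis
        by (rule Lim_transform_eventually)
    qed
    show "u \<in> Lp (2 * \<sigma> + 2)" by (rule finite_H(2))
    have "S \<in> \<Theta>[at_top](\<lambda>\<rho>. c 1 * B 1 \<rho>)"
      using equiv by (rule asymp_equiv_imp_bigtheta)
    also have "(\<lambda>\<rho>. c 1 * B 1 \<rho>) \<in> \<Theta>[at_top](pw (- 2 / \<sigma>))"
      using B1[of 0] c1 by simp
    finally have "S \<in> \<Omega>[at_top](pw (- 2 / \<sigma>))"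
      by (rule bigthetaD2)
    \<comment> \<open>Equivalent to \<sigma> d being at least 4: the squared profile decays no
      faster than the critical power for integrability.\<close>
    moreover have "2 * (- 2 / \<sigma>) \<ge> - real DIM(real ^ 'd)"
      using \<sigma>d \<sigma> d by (simp add: field_simps)
    ultimately show "u \<notin> Lp 2"
      unfolding u by (intro radial_not_in_Lp[of _ S]) (auto simp: radial_def)
  qed
  show ?thesis
    using c2 c3 main by blast
qed

end
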